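(* Let $(\Phi(z),\Psi(z))$ be a pair of jointly Gaussian $\mathcal{D}_0$-GAFs. For $a,b\in\mathbb{C}$, we have the estimate \[ \int_{\mathbb{D}}\big|a\,w\,\mathbb{E}\,\Phi(z)\Psi'(w)+b\,\bar w\,\mathbb{E}\,\Phi(z)\overline{\Psi'(w)}\big|^2\,\frac{dA(w)}{|w|^2}\le(|a|^2+|b|^2)\log\frac{1}{1-|z|^2},\qquad z\in\mathbb{D}. \]
   Context: $\mathbb{D}=\{z\in\mathbb{C}:|z|<1\}$, and $dA(w)=\frac{1}{\pi}\,dx\,dy$ ($w=x+iy$) is normalized area measure. A Gaussian Hilbert space $\mathfrak{G}$ is a closed ($\mathbb{C}$-linear) subspace of $L^2(\Omega,dP)$, for a probability space $(\Omega,dP)$, each of whose elements has a complex Gaussian distribution with mean $0$ (real and imaginary parts are jointly Gaussian with mean $0$); $\mathfrak{G}$ is assumed conjugation-invariant ($\gamma\in\mathfrak{G}\iff\bar\gamma\in\mathfrak{G}$). $\mathbb{E}$ denotes expectation, $\mathbb{E}\gamma=\int_\Omega\gamma\,dP$. A standard complex Gaussian variable is a mean-zero complex Gaussian $\gamma$ with $\mathbb{E}(\gamma^2)=0$ and $\mathbb{E}(|\gamma|^2)=1$. A pair of jointly Gaussian $\mathcal{D}_0$-GAFs is a pair $(\Phi,\Psi)$ of random analytic functions on $\mathbb{D}$, \[ \Phi(z)=\sum_{j=1}^{+\infty}\frac{\alpha_j}{\sqrt{j}}\,z^j,\qquad \Psi(z)=\sum_{j=1}^{+\infty}\frac{\beta_j}{\sqrt{j}}\,z^j,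 \] where $\alpha_1,\alpha_2,\ldots$ are i.i.d. standard complex Gaussian variables, $\beta_1,\beta_2,\ldots$ are i.i.d. standard complex Gaussian variables, and all the $\alpha_j$ and $\beta_j$ are taken from one and the same Gaussian Hilbert space $\mathfrak{G}$ (no assumption is made on the correlations between the $\alpha_j$ and the $\beta_k$). Here $\Psi'(w)=\sum_{j\ge1}\sqrt{j}\,\beta_j\,w^{j-1}$ is the complex derivative. *)

theory Defs
  imports "HOL-Probability.Probability" "HOL-Complex_Analysis.Complex_Analysis"
begin

abbreviation unit_disk :: "complex set" where
  "unit_disk \<equiv> ball 0 1"

definition dA :: "complex measure" where
  "dA = density lborel (\<lambda>_. ennreal (1 / pi))"

text \<open>Degenerate Gaussians are allowed: a linear space of Gaussian variables contains 0.\<close>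

definition centered_gaussian :: "'w measure \<Rightarrow> ('w \<Rightarrow> real) \<Rightarrow> bool" where
  "centered_gaussian M X \<longleftrightarrow> X \<in> borel_measurable M \<and>
     ((AE \<omega> in M. X \<omega> = 0) \<or> (\<exists>\<sigma>>0. distributed M lborel X (normal_density 0 \<sigma>)))"

text \<open>Real and imaginary parts are jointly Gaussian, in the usual sense that every real linear
  combination of them is Gaussian.\<close>

definition centered_complex_gaussian :: "'w measure \<Rightarrow> ('w \<Rightarrow> complex) \<Rightarrow> bool" where
  "centered_complex_gaussian M \<gamma> \<longleftrightarrow> \<gamma> \<in> borel_measurable M \<and>
     (\<forall>s t. centered_gaussian M (\<lambda>\<omega>. s * Re (\<gamma> \<omega>) + t * Im (\<gamma> \<omega>)))"

definition standard_complex_gaussian :: "'w measure \<Rightarrow> ('w \<Rightarrow> complex) \<Rightarrow> bool" where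
  "standard_complex_gaussian M \<gamma> \<longleftrightarrow> centered_complex_gaussian M \<gamma> \<and>
     (\<integral>\<omega>. (\<gamma> \<omega>)\<^sup>2 \<partial>M) = 0 \<and> (\<integral>\<omega>. (cmod (\<gamma> \<omega>))\<^sup>2 \<partial>M) = 1"

definition square_integrable :: "'w measure \<Rightarrow> ('w \<Rightarrow> complex) \<Rightarrow> bool" where
  "square_integrable M f \<longleftrightarrow> f \<in> borel_measurable M \<and> integrable M (\<lambda>\<omega>. (cmod (f \<omega>))\<^sup>2)"

text \<open>The subspace of \<open>L\<^sup>2\<close> is given by the set of all representatives of its elements.
  The axiom \<open>closed\<close>, applied to constant sequences, makes it invariant under changes
  on null sets.\<close>

locale gaussian_hilbert_space = prob_space M for M :: "'w measure" +
  fixes G :: "('w \<Rightarrow> complex) set"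
  assumes square_integrable: "f \<in> G \<Longrightarrow> square_integrable M f"
    and zero: "(\<lambda>_. 0) \<in> G"
    and add: "f \<in> G \<Longrightarrow> g \<in> G \<Longrightarrow> (\<lambda>\<omega>. f \<omega> + g \<omega>) \<in> G"
    and scale: "f \<in> G \<Longrightarrow> (\<lambda>\<omega>. c * f \<omega>) \<in> G"
    and closed: "(\<And>n. F n \<in> G) \<Longrightarrow> square_integrable M f \<Longrightarrow>
      (\<lambda>n::nat. \<integral>\<omega>. (cmod (F n \<omega> - f \<omega>))\<^sup>2 \<partial>M) \<longlonglongrightarrow> 0 \<Longrightarrow> f \<in> G"
    and gaussian: "f \<in> G \<Longrightarrow> centered_complex_gaussian M f"
    and cnj: "f \<in> G \<Longrightarrow> (\<lambda>\<omega>. cnj (f \<omega>)) \<in> G"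

definition random_analytic_function :: "'w measure \<Rightarrow> (complex \<Rightarrow> 'w \<Rightarrow> complex) \<Rightarrow> bool" where
  "random_analytic_function M \<Phi> \<longleftrightarrow>
     (\<forall>z\<in>unit_disk. \<Phi> z \<in> borel_measurable M) \<and>
     (\<forall>\<omega>\<in>space M. (\<lambda>z. \<Phi> z \<omega>) holomorphic_on unit_disk)"

text \<open>The index 0 of \<open>\<alpha>\<close> is unused. Standard complex Gaussian variables are
  identically distributed, so of ``i.i.d.'' only independence has to be required. The power series
  converges on the whole disk only almost surely, whence the exceptional null set.\<close>

definition D0_GAF ::
    "'w measure \<Rightarrow> ('w \<Rightarrow> complex) set \<Rightarrow> (complex \<Rightarrow> 'w \<Rightarrow> complex) \<Rightarrow> bool" where
  "D0_GAF M G \<Phi> \<longleftrightarrow> random_analytic_function M \<Phi> \<and>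
     (\<exists>\<alpha> :: nat \<Rightarrow> 'w \<Rightarrow> complex.
        (\<forall>j\<ge>1. \<alpha> j \<in> G \<and> standard_complex_gaussian M (\<alpha> j)) \<and>
        prob_space.indep_vars M (\<lambda>_. borel) \<alpha> {1..} \<and>
        (AE \<omega> in M. \<forall>z\<in>unit_disk.
           (\<lambda>j. \<alpha> (Suc j) \<omega> / complex_of_real (sqrt (real (Suc j))) * z ^ Suc j) sums \<Phi> z \<omega>))"

definition jointly_gaussian_D0_GAFs ::
    "'w measure \<Rightarrow> ('w \<Rightarrow> complex) set \<Rightarrow> (complex \<Rightarrow> 'w \<Rightarrow> complex) \<Rightarrow>
      (complex \<Rightarrow> 'w \<Rightarrow> complex) \<Rightarrow> bool" where
  "jointly_gaussian_D0_GAFs M G \<Phi> \<Psi> \<longleftrightarrow>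
     gaussian_hilbert_space M G \<and> D0_GAF M G \<Phi> \<and> D0_GAF M G \<Psi>"

definition random_deriv ::
    "(complex \<Rightarrow> 'w \<Rightarrow> complex) \<Rightarrow> complex \<Rightarrow> 'w \<Rightarrow> complex" where
  "random_deriv \<Psi> w \<omega> = deriv (\<lambda>u. \<Psi> u \<omega>) w"

text \<open>The value at \<open>w = 0\<close>, which is 0 because of division by zero, is irrelevant:
  the origin is a null set.\<close>

definition correlation_integrand ::
    "'w measure \<Rightarrow> (complex \<Rightarrow> 'w \<Rightarrow> complex) \<Rightarrow> (complex \<Rightarrow> 'w \<Rightarrow> complex) \<Rightarrow>
      complex \<Rightarrow> complex \<Rightarrow> complex \<Rightarrow> complex \<Rightarrow> real" where
  "correlation_integrand M \<Phi> \<Psi> a b z w =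
     (cmod (a * w * (\<integral>\<omega>. \<Phi> z \<omega> * random_deriv \<Psi> w \<omega> \<partial>M)
          + b * cnj w * (\<integral>\<omega>. \<Phi> z \<omega> * cnj (random_deriv \<Psi> w \<omega>) \<partial>M)))\<^sup>2 / (cmod w)\<^sup>2"

end

theory Submission imports Defs begin

text \<open>Write \<open>\<Psi>' = \<Sum>\<^sub>k sqrt k \<beta>\<^sub>k w\<^bsup>k-1\<^esup>\<close>, \<open>c\<^sub>k = E (\<Phi>(z) \<beta>\<^sub>k)\<close> and
  \<open>d\<^sub>k = E (\<Phi>(z) cnj \<beta>\<^sub>k)\<close>. The expression under the modulus is the sum of
  \<open>sqrt k (a c\<^sub>k w\<^bsup>k\<^esup> + b d\<^sub>k (cnj w)\<^bsup>k\<^esup>)\<close>, and the functions \<open>sqrt k w\<^bsup>k\<^esup> / \<bar>w\<bar>\<close> and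
  \<open>sqrt k (cnj w)\<^bsup>k\<^esup> / \<bar>w\<bar>\<close> together are orthonormal in \<open>L\<^sup>2\<close> of the disk. Hence the integral is
  \<open>\<Sum>\<^sub>k \<bar>a\<bar>\<^sup>2 \<bar>c\<^sub>k\<bar>\<^sup>2 + \<bar>b\<bar>\<^sup>2 \<bar>d\<^sub>k\<bar>\<^sup>2\<close>, and Bessel's inequality bounds both \<open>\<Sum>\<^sub>k \<bar>c\<^sub>k\<bar>\<^sup>2\<close> and
  \<open>\<Sum>\<^sub>k \<bar>d\<^sub>k\<bar>\<^sup>2\<close> by \<open>E \<bar>\<Phi>(z)\<bar>\<^sup>2 = \<Sum>\<^sub>j \<bar>z\<bar>\<^bsup>2j\<^esup> / j = log (1 / (1 - \<bar>z\<bar>\<^sup>2))\<close>. The series converge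
  only almost surely, respectively pointwise; Fatou's lemma turns this into the \<open>L\<^sup>2\<close> bounds, so
  no completeness of \<open>L\<^sup>2\<close> is needed.\<close>

section \<open>Orthonormal families of square integrable functions\<close>

lemma square_integrable_mult:
  assumes "square_integrable M f" "square_integrable M g"
  shows "integrable M (\<lambda>x. f x * g x)"
proof (rule Bochner_Integration.integrable_bound)
  show "integrable M (\<lambda>x. (cmod (f x))\<^sup>2 + (cmod (g x))\<^sup>2)"
    using assms by (auto simp: square_integrable_def)
  show "(\<lambda>x. f x * g x) \<in> borel_measurable M"
    using assms by (auto simp: square_integrable_def)
  show "AE x in M. norm (f x * g x) \<le> norm ((cmod (f x))\<^sup>2 + (cmod (g x))\<^sup>2)"
  proof (rule AE_I2)
    fix x
    have "2 * (cmod (f x) * cmod (g x)) \<le> (cmod (f x))\<^sup>2 + (cmod (g x))\<^sup>2"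
      using sum_squares_bound[of "cmod (f x)" "cmod (g x)"] by simp
    moreover have "0 \<le> cmod (f x) * cmod (g x)" by simp
    ultimately have "cmod (f x) * cmod (g x) \<le> (cmod (f x))\<^sup>2 + (cmod (g x))\<^sup>2" by linarith
    then show "norm (f x * g x) \<le> norm ((cmod (f x))\<^sup>2 + (cmod (g x))\<^sup>2)"
      by (simp add: norm_mult)
  qed
qed

lemma borel_measurable_cnj [measurable]: "cnj \<in> borel_measurable borel"
  by (intro borel_measurable_continuous_onI continuous_intros)

lemma square_integrable_cnj [intro]:
  "square_integrable M f \<Longrightarrow> square_integrable M (\<lambda>x. cnj (f x))"
  using measurable_compose[of f M borel cnj borel] borel_measurable_cnj
  by (auto simp: square_integrable_def)

lemma square_integrable_cmult [intro]:
  "square_integrable M f \<Longrightarrow> square_integrable M (\<lambda>x. c * f x)"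
  by (auto simp: square_integrable_def norm_mult power_mult_distrib)

lemma square_integrable_add [intro]:
  assumes "square_integrable M f" "square_integrable M g"
  shows "square_integrable M (\<lambda>x. f x + g x)"
proof -
  have [measurable]: "f \<in> borel_measurable M" "g \<in> borel_measurable M"
    using assms by (auto simp: square_integrable_def)
  have "integrable M (\<lambda>x. (cmod (f x + g x))\<^sup>2)"
  proof (rule Bochner_Integration.integrable_bound)
    show "integrable M (\<lambda>x. 2 * (cmod (f x))\<^sup>2 + 2 * (cmod (g x))\<^sup>2)"
      using assms by (auto simp: square_integrable_def)
    show "AE x in M. norm ((cmod (f x + g x))\<^sup>2) \<le> norm (2 * (cmod (f x))\<^sup>2 + 2 * (cmod (g x))\<^sup>2)"
    proof (rule AE_I2)
      fix x
      have "(cmod (f x + g x))\<^sup>2 \<le> (cmod (f x) + cmod (g x))\<^sup>2"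
        by (intro power_mono norm_triangle_ineq) simp
      also have "\<dots> \<le> 2 * (cmod (f x))\<^sup>2 + 2 * (cmod (g x))\<^sup>2"
        using sum_squares_bound[of "cmod (f x)" "cmod (g x)"] by (simp add: power2_sum)
      finally show "norm ((cmod (f x + g x))\<^sup>2) \<le> norm (2 * (cmod (f x))\<^sup>2 + 2 * (cmod (g x))\<^sup>2)"
        by simp
    qed
  qed simp
  then show ?thesis by (simp add: square_integrable_def)
qed

lemma square_integrable_diff [intro]:
  assumes "square_integrable M f" "square_integrable M g"
  shows "square_integrable M (\<lambda>x. f x - g x)"
  using square_integrable_add[OF assms(1) square_integrable_cmult[OF assms(2), of "-1"]] by simp

lemma square_integrable_sum [intro]:
  assumes "\<And>i. i \<in> I \<Longrightarrow> square_integrable M (f i)"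
  shows "square_integrable M (\<lambda>x. \<Sum>i\<in>I. f i x)"
  using assms
proof (induction I rule: infinite_finite_induct)
  case (insert i I)
  then show ?case by (simp add: square_integrable_add)
qed (auto simp: square_integrable_def)

lemma complex_of_real_integral_norm_squared:
  "complex_of_real (\<integral>x. (cmod (f x))\<^sup>2 \<partial>M) = (\<integral>x. f x * cnj (f x) \<partial>M)"
proof -
  have "complex_of_real (\<integral>x. (cmod (f x))\<^sup>2 \<partial>M) = (\<integral>x. complex_of_real ((cmod (f x))\<^sup>2) \<partial>M)"
    by (rule integral_complex_of_real[symmetric])
  then show ?thesis by (simp only: complex_norm_square)
qed

text \<open>The inequality for nonnegative integrals is applied to the moduli. The product carries
  no conjugate, so the bound fits the bilinear pairing in
  \<open>orthonormal_series_integral\<close>.\<close>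

lemma Cauchy_Schwarz_integral:
  assumes "square_integrable M f" "square_integrable M g"
  shows "(cmod (\<integral>x. f x * g x \<partial>M))\<^sup>2 \<le> (\<integral>x. (cmod (f x))\<^sup>2 \<partial>M) * (\<integral>x. (cmod (g x))\<^sup>2 \<partial>M)"
proof -
  have [measurable]: "f \<in> borel_measurable M" "g \<in> borel_measurable M"
    and int: "integrable M (\<lambda>x. (cmod (f x))\<^sup>2)" "integrable M (\<lambda>x. (cmod (g x))\<^sup>2)"
    using assms by (auto simp: square_integrable_def)
  have fg: "integrable M (\<lambda>x. cmod (f x * g x))"
    using square_integrable_mult[OF assms] by simp
  have "ennreal ((\<integral>x. cmod (f x * g x) \<partial>M)\<^sup>2) = (\<integral>\<^sup>+x. ennreal (cmod (f x)) * ennreal (cmod (g x)) \<partial>M)\<^sup>2"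
    using nn_integral_eq_integral[OF fg]
    by (simp add: norm_mult ennreal_mult ennreal_power)
  also have "\<dots> \<le> (\<integral>\<^sup>+x. ennreal (cmod (f x)) ^ 2 \<partial>M) * (\<integral>\<^sup>+x. ennreal (cmod (g x)) ^ 2 \<partial>M)"
    by (rule Cauchy_Schwarz_nn_integral) auto
  also have "\<dots> = ennreal ((\<integral>x. (cmod (f x))\<^sup>2 \<partial>M) * (\<integral>x. (cmod (g x))\<^sup>2 \<partial>M))"
    using nn_integral_eq_integral[OF int(1)] nn_integral_eq_integral[OF int(2)]
    by (simp add: ennreal_mult ennreal_power)
  finally have "(\<integral>x. cmod (f x * g x) \<partial>M)\<^sup>2 \<le> (\<integral>x. (cmod (f x))\<^sup>2 \<partial>M) * (\<integral>x. (cmod (g x))\<^sup>2 \<partial>M)"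
    by (subst (asm) ennreal_le_iff) auto
  moreover have "(cmod (\<integral>x. f x * g x \<partial>M))\<^sup>2 \<le> (\<integral>x. cmod (f x * g x) \<partial>M)\<^sup>2"
    by (intro power_mono integral_norm_bound) auto
  ultimately show ?thesis by linarith
qed

text \<open>The index type is left free: Gaussian coefficients are indexed by \<open>nat\<close>,
  the functions on the disk by \<open>nat \<times> bool\<close>.\<close>

definition orthonormal :: "'a measure \<Rightarrow> ('i \<Rightarrow> 'a \<Rightarrow> complex) \<Rightarrow> bool" where
  "orthonormal M e \<longleftrightarrow> (\<forall>i. square_integrable M (e i)) \<and>
     (\<forall>i j. (\<integral>x. e i x * cnj (e j x) \<partial>M) = (if i = j then 1 else 0))"

lemma orthonormal_square_integrable [intro]: "orthonormal M e \<Longrightarrow> square_integrable M (e i)"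
  by (simp add: orthonormal_def)

text \<open>Conjugating the family only exchanges the roles of \<open>i\<close> and
  \<open>j\<close>. This lets the correlations with \<open>\<Psi>'\<close> and with its conjugate be
  handled by the same results.\<close>

lemma orthonormal_cnj:
  assumes "orthonormal M e"
  shows "orthonormal M (\<lambda>i x. cnj (e i x))"
proof -
  have "(\<integral>x. cnj (e i x) * e j x \<partial>M) = (if i = j then 1 else 0)" for i j
  proof -
    have "(\<integral>x. cnj (e i x) * e j x \<partial>M) = (\<integral>x. e j x * cnj (e i x) \<partial>M)"
      by (simp add: mult.commute)
    with assms show ?thesis
      unfolding orthonormal_def by (metis (no_types))
  qed
  with assms show ?thesis by (auto simp: orthonormal_def)
qed

lemma integral_norm_squared_orthonormal_sum:
  assumes "orthonormal M e" "finite I"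
  shows "(\<integral>x. (cmod (\<Sum>i\<in>I. c i * e i x))\<^sup>2 \<partial>M) = (\<Sum>i\<in>I. (cmod (c i))\<^sup>2)"
proof -
  have si: "square_integrable M (e i)" for i
    using assms by blast
  have int: "integrable M (\<lambda>x. (c i * cnj (c j)) * (e i x * cnj (e j x)))" for i j
    by (intro integrable_mult_right square_integrable_mult si square_integrable_cnj)
  have "complex_of_real (\<integral>x. (cmod (\<Sum>i\<in>I. c i * e i x))\<^sup>2 \<partial>M)
      = (\<integral>x. (\<Sum>i\<in>I. \<Sum>j\<in>I. (c i * cnj (c j)) * (e i x * cnj (e j x))) \<partial>M)"
    unfolding complex_of_real_integral_norm_squared
    by (simp add: sum_product mult_ac)
  also have "\<dots> = (\<Sum>i\<in>I. \<Sum>j\<in>I. (c i * cnj (c j)) * (if i = j then 1 else 0))"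
    using assms int
    by (simp add: Bochner_Integration.integral_sum Bochner_Integration.integrable_sum orthonormal_def)
  also have "\<dots> = (\<Sum>i\<in>I. c i * cnj (c i))"
    using assms by (simp add: if_distrib sum.delta cong: if_cong)
  also have "\<dots> = complex_of_real (\<Sum>i\<in>I. (cmod (c i))\<^sup>2)"
    by (simp only: complex_norm_square of_real_sum)
  finally show ?thesis using of_real_eq_iff by blast
qed

text \<open>Let \<open>s\<close> be the orthogonal projection of \<open>f\<close> onto the span of
  the \<open>e i\<close>. Its pairing with \<open>f\<close> and its own squared norm both equal the
  sum on the left, so expanding the squared norm of \<open>f - s\<close>, which is nonnegative,
  gives the claim.\<close>

lemma Bessel_inequality:
  assumes "orthonormal M e" "finite I" "square_integrable M f"
  shows "(\<Sum>i\<in>I. (cmod (\<integral>x. f x * cnj (e i x) \<partial>M))\<^sup>2) \<le> (\<integral>x. (cmod (f x))\<^sup>2 \<partial>M)"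
proof -
  define c where "c i = (\<integral>x. f x * cnj (e i x) \<partial>M)" for i
  define s where "s x = (\<Sum>i\<in>I. c i * e i x)" for x
  have si: "square_integrable M (e i)" for i
    using assms by blast
  have ss: "square_integrable M s"
    unfolding s_def by (intro square_integrable_sum square_integrable_cmult si)
  have fs: "(\<integral>x. f x * cnj (s x) \<partial>M) = (\<Sum>i\<in>I. (cmod (c i))\<^sup>2)"
  proof -
    have "(\<integral>x. f x * cnj (s x) \<partial>M) = (\<integral>x. (\<Sum>i\<in>I. cnj (c i) * (f x * cnj (e i x))) \<partial>M)"
      by (simp add: s_def sum_distrib_left mult_ac)
    also have "\<dots> = (\<Sum>i\<in>I. cnj (c i) * c i)"
      using assms si
      by (subst Bochner_Integration.integral_sum)
         (auto simp: c_def intro!: integrable_mult_right square_integrable_mult)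
    also have "\<dots> = complex_of_real (\<Sum>i\<in>I. (cmod (c i))\<^sup>2)"
      by (simp only: complex_norm_square of_real_sum mult.commute)
    finally show ?thesis .
  qed
  have fsi: "integrable M (\<lambda>x. f x * cnj (s x))"
    by (intro square_integrable_mult square_integrable_cnj assms ss)
  have "0 \<le> (\<integral>x. (cmod (f x - s x))\<^sup>2 \<partial>M)" by simp
  also have "\<dots> = (\<integral>x. (cmod (f x))\<^sup>2 - 2 * Re (f x * cnj (s x)) + (cmod (s x))\<^sup>2 \<partial>M)"
    by (intro Bochner_Integration.integral_cong refl)
       (simp only: cmod_power2, simp add: power2_eq_square algebra_simps)
  \<comment> \<open>Deleting the simplification rules keeps the product under \<open>Re\<close>
    intact, so that the integrability facts at hand match it.\<close>
  also have "\<dots> = (\<integral>x. (cmod (f x))\<^sup>2 \<partial>M) - 2 * Re (\<integral>x. f x * cnj (s x) \<partial>M) + (\<integral>x. (cmod (s x))\<^sup>2 \<partial>M)"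
    unfolding integral_Re[OF fsi, symmetric]
    using assms(3) ss integrable_Re[OF fsi]
    by (simp add: square_integrable_def del: complex_mult_cnj integral_Re times_complex.sel complex_cnj)
  also have "(\<integral>x. (cmod (s x))\<^sup>2 \<partial>M) = (\<Sum>i\<in>I. (cmod (c i))\<^sup>2)"
    unfolding s_def by (rule integral_norm_squared_orthonormal_sum[OF assms(1,2)])
  finally show ?thesis
    by (simp add: fs c_def)
qed

section \<open>Orthonormal series that converge almost everywhere\<close>

text \<open>A uniform bound on squared norms survives an almost everywhere limit, by Fatou's lemma
  for the squared moduli. It is used both on the probability space and on the disk.\<close>

lemma Fatou_square_integrable:
  assumes T: "\<And>n. square_integrable M (T n)"
    and bound: "\<And>n::nat. (\<integral>x. (cmod (T n x))\<^sup>2 \<partial>M) \<le> C"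
    and lim: "AE x in M. (\<lambda>n. T n x) \<longlonglongrightarrow> f x"
    and [measurable]: "f \<in> borel_measurable M"
  shows "square_integrable M f" "(\<integral>x. (cmod (f x))\<^sup>2 \<partial>M) \<le> C"
proof -
  have [measurable]: "T n \<in> borel_measurable M" for n
    using T by (auto simp: square_integrable_def)
  \<comment> \<open>The sign of \<open>C\<close> matters at the end, because \<open>ennreal\<close>
    sends negative reals to 0.\<close>
  have "0 \<le> (\<integral>x. (cmod (T 0 x))\<^sup>2 \<partial>M)" by simp
  with bound[of 0] have C: "0 \<le> C" by linarith
  have "(\<integral>\<^sup>+x. ennreal ((cmod (f x))\<^sup>2) \<partial>M) = (\<integral>\<^sup>+x. liminf (\<lambda>n. ennreal ((cmod (T n x))\<^sup>2)) \<partial>M)"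
  proof (rule nn_integral_cong_AE, use lim in eventually_elim)
    fix x assume "(\<lambda>n. T n x) \<longlonglongrightarrow> f x"
    then have "(\<lambda>n. ennreal ((cmod (T n x))\<^sup>2)) \<longlonglongrightarrow> ennreal ((cmod (f x))\<^sup>2)"
      by (intro tendsto_intros)
    then show "ennreal ((cmod (f x))\<^sup>2) = liminf (\<lambda>n. ennreal ((cmod (T n x))\<^sup>2))"
      using lim_imp_Liminf sequentially_bot by metis
  qed
  also have "\<dots> \<le> liminf (\<lambda>n. \<integral>\<^sup>+x. ennreal ((cmod (T n x))\<^sup>2) \<partial>M)"
    by (rule nn_integral_liminf) simp
  also have "\<dots> \<le> liminf (\<lambda>n::nat. ennreal C)"
  proof (intro Liminf_mono always_eventually allI)
    fix n
    have "(\<integral>\<^sup>+x. ennreal ((cmod (T n x))\<^sup>2) \<partial>M) = ennreal (\<integral>x. (cmod (T n x))\<^sup>2 \<partial>M)"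
      using T by (intro nn_integral_eq_integral) (auto simp: square_integrable_def)
    then show "(\<integral>\<^sup>+x. ennreal ((cmod (T n x))\<^sup>2) \<partial>M) \<le> ennreal C"
      using bound by (simp add: ennreal_leI)
  qed
  also have "\<dots> = ennreal C" by (simp add: Liminf_const)
  finally have *: "(\<integral>\<^sup>+x. ennreal ((cmod (f x))\<^sup>2) \<partial>M) \<le> ennreal C" .
  have int: "integrable M (\<lambda>x. (cmod (f x))\<^sup>2)"
    using * by (intro integrableI_bounded) (auto simp: le_less_trans)
  then show "square_integrable M f" by (simp add: square_integrable_def)
  show "(\<integral>x. (cmod (f x))\<^sup>2 \<partial>M) \<le> C"
    using * C by (simp add: nn_integral_eq_integral[OF int])
qed

text \<open>Each partial sum has squared norm equal to a partial sum of the coefficient series, so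
  the total is a uniform bound to which Fatou's lemma applies.\<close>

lemma orthonormal_series:
  fixes e :: "nat \<Rightarrow> 'a \<Rightarrow> complex"
  assumes "orthonormal M e" and sum: "summable (\<lambda>k. (cmod (c k))\<^sup>2)"
    and lim: "AE x in M. (\<lambda>k. c k * e k x) sums f x"
    and meas: "f \<in> borel_measurable M"
  shows "square_integrable M f" "(\<integral>x. (cmod (f x))\<^sup>2 \<partial>M) \<le> (\<Sum>k. (cmod (c k))\<^sup>2)"
proof -
  have si: "square_integrable M (\<lambda>x. \<Sum>k<n. c k * e k x)" for n
    using assms(1) by (intro square_integrable_sum square_integrable_cmult) auto
  have b: "(\<integral>x. (cmod (\<Sum>k<n. c k * e k x))\<^sup>2 \<partial>M) \<le> (\<Sum>k. (cmod (c k))\<^sup>2)" for n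
    using assms(1) sum by (simp add: integral_norm_squared_orthonormal_sum sum_le_suminf)
  have l: "AE x in M. (\<lambda>n. \<Sum>k<n. c k * e k x) \<longlonglongrightarrow> f x"
    using lim by (simp add: sums_def)
  show "square_integrable M f" "(\<integral>x. (cmod (f x))\<^sup>2 \<partial>M) \<le> (\<Sum>k. (cmod (c k))\<^sup>2)"
    by (fact Fatou_square_integrable[OF si b l meas])+
qed

text \<open>The series may be integrated term by term against \<open>g\<close>: by Cauchy-Schwarz
  the error after \<open>n\<close> terms is at most the norm of \<open>g\<close> times the norm of
  the remainder, and the latter is controlled by a tail of the coefficient series.\<close>

lemma orthonormal_series_integral:
  fixes e :: "nat \<Rightarrow> 'a \<Rightarrow> complex"
  assumes orth: "orthonormal M e" and sum: "summable (\<lambda>k. (cmod (c k))\<^sup>2)"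
    and lim: "AE x in M. (\<lambda>k. c k * e k x) sums f x"
    and meas: "f \<in> borel_measurable M" and g: "square_integrable M g"
  shows "(\<lambda>k. c k * (\<integral>x. g x * e k x \<partial>M)) sums (\<integral>x. g x * f x \<partial>M)"
proof -
  define T where "T n x = (\<Sum>k<n. c k * e k x)" for n x
  define C where "C = (\<integral>x. (cmod (g x))\<^sup>2 \<partial>M)"
  have si: "square_integrable M (e k)" for k
    using orth by blast
  have f: "square_integrable M f"
    by (rule orthonormal_series[OF orth sum lim meas])
  have T: "square_integrable M (T n)" for n
    unfolding T_def by (intro square_integrable_sum square_integrable_cmult si)
  \<comment> \<open>The remainder is itself the sum of an orthonormal series, the one with indices
    shifted by \<open>n\<close>, so the preceding bound applies to it.\<close>
  have rem: "(\<integral>x. (cmod (f x - T n x))\<^sup>2 \<partial>M) \<le> (\<Sum>k. (cmod (c (k + n)))\<^sup>2)" for n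
  proof (rule orthonormal_series)
    show "orthonormal M (\<lambda>k. e (k + n))"
      using orth by (auto simp: orthonormal_def)
    show "summable (\<lambda>k. (cmod (c (k + n)))\<^sup>2)"
      using sum by (rule summable_ignore_initial_segment)
    show "AE x in M. (\<lambda>k. c (k + n) * e (k + n) x) sums (f x - T n x)"
      using lim by eventually_elim
        (unfold T_def, rule sums_split_initial_segment[of "\<lambda>k. c k * e k _"])
    show "(\<lambda>x. f x - T n x) \<in> borel_measurable M"
      using square_integrable_diff[OF f T] by (simp add: square_integrable_def)
  qed
  have eq: "(\<Sum>k<n. c k * (\<integral>x. g x * e k x \<partial>M)) = (\<integral>x. g x * T n x \<partial>M)" for n
  proof -
    have "(\<integral>x. g x * T n x \<partial>M) = (\<integral>x. (\<Sum>k<n. c k * (g x * e k x)) \<partial>M)"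
      by (simp add: T_def sum_distrib_left mult_ac)
    also have "\<dots> = (\<Sum>k<n. c k * (\<integral>x. g x * e k x \<partial>M))"
      using g si by (subst Bochner_Integration.integral_sum)
        (auto intro!: integrable_mult_right square_integrable_mult)
    finally show ?thesis ..
  qed
  have bound: "cmod ((\<integral>x. g x * T n x \<partial>M) - (\<integral>x. g x * f x \<partial>M)) \<le> sqrt (C * (\<Sum>k. (cmod (c (k + n)))\<^sup>2))" for n
  proof (rule real_le_rsqrt)
    have "(\<integral>x. g x * T n x \<partial>M) - (\<integral>x. g x * f x \<partial>M) = - (\<integral>x. g x * (f x - T n x) \<partial>M)"
      using square_integrable_mult[OF g T[of n]] square_integrable_mult[OF g f]
      by (simp add: algebra_simps)
    then have "(cmod ((\<integral>x. g x * T n x \<partial>M) - (\<integral>x. g x * f x \<partial>M)))\<^sup>2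
        \<le> C * (\<integral>x. (cmod (f x - T n x))\<^sup>2 \<partial>M)"
      using Cauchy_Schwarz_integral[OF g square_integrable_diff[OF f T[of n]]] by (simp add: C_def)
    also have "\<dots> \<le> C * (\<Sum>k. (cmod (c (k + n)))\<^sup>2)"
      by (intro mult_left_mono rem) (simp add: C_def)
    finally show "(cmod ((\<integral>x. g x * T n x \<partial>M) - (\<integral>x. g x * f x \<partial>M)))\<^sup>2
        \<le> C * (\<Sum>k. (cmod (c (k + n)))\<^sup>2)" .
  qed
  have "(\<lambda>n. sqrt (C * (\<Sum>k. (cmod (c (k + n)))\<^sup>2))) \<longlonglongrightarrow> sqrt (C * 0)"
    by (intro tendsto_intros suminf_exist_split2 sum)
  then have "(\<lambda>n. sqrt (C * (\<Sum>k. (cmod (c (k + n)))\<^sup>2))) \<longlonglongrightarrow> 0"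
    by simp
  from Lim_null_comparison[OF always_eventually[OF allI[OF bound]] this]
  have "(\<lambda>n. (\<integral>x. g x * T n x \<partial>M) - (\<integral>x. g x * f x \<partial>M)) \<longlonglongrightarrow> 0" .
  then show ?thesis
    unfolding sums_def eq by (rule LIM_zero_cancel)
qed

section \<open>Rotations and the area measure of the disk\<close>

lemma borel_measurable_Complex [measurable]:
  assumes [measurable]: "f \<in> borel_measurable M" "g \<in> borel_measurable M"
  shows "(\<lambda>x. Complex (f x) (g x)) \<in> borel_measurable M"
  unfolding Complex_eq by measurable

text \<open>Lebesgue measure is determined by its values on boxes, and a box in the plane is a
  product of two intervals. This makes Tonelli's theorem available in the coordinates
  \<open>Re\<close> and \<open>Im\<close>.\<close>

lemma lborel_complex_eq:
  "(lborel :: complex measure) = distr (lborel \<Otimes>\<^sub>M lborel) borel (\<lambda>p. Complex (fst p) (snd p))"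
proof (rule lborel_eqI)
  fix l u :: complex assume "\<And>b. b \<in> Basis \<Longrightarrow> l \<bullet> b \<le> u \<bullet> b"
  from this[of 1] this[of \<i>] have le: "Re l \<le> Re u" "Im l \<le> Im u"
    by (auto simp: Basis_complex_def)
  have "(\<lambda>p. Complex (fst p) (snd p)) -` box l u = {Re l<..<Re u} \<times> {Im l<..<Im u}"
    by (auto simp: box_def Basis_complex_def)
  then have "emeasure (distr (lborel \<Otimes>\<^sub>M lborel) borel (\<lambda>p. Complex (fst p) (snd p))) (box l u)
      = emeasure (lborel \<Otimes>\<^sub>M lborel) ({Re l<..<Re u} \<times> {Im l<..<Im u})"
    by (subst emeasure_distr) (auto simp: space_pair_measure)
  also have "\<dots> = ennreal (Re u - Re l) * ennreal (Im u - Im l)"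
    using le by (subst lborel.emeasure_pair_measure_Times) auto
  also have "\<dots> = ennreal (\<Prod>b\<in>Basis. (u - l) \<bullet> b)"
    using le by (simp add: Basis_complex_def ennreal_mult)
  finally show "emeasure (distr (lborel \<Otimes>\<^sub>M lborel) borel (\<lambda>p. Complex (fst p) (snd p))) (box l u)
      = ennreal (\<Prod>b\<in>Basis. (u - l) \<bullet> b)" .
qed simp

text \<open>Both orders of integration are recorded: a horizontal shear calls for integrating over
  \<open>x\<close> first, a vertical one over \<open>y\<close> first.\<close>

lemma nn_integral_lborel_complex:
  assumes [measurable]: "f \<in> borel_measurable borel"
  shows "(\<integral>\<^sup>+z. f z \<partial>lborel) = (\<integral>\<^sup>+x. \<integral>\<^sup>+y. f (Complex x y) \<partial>lborel \<partial>lborel)"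
    and "(\<integral>\<^sup>+z. f z \<partial>lborel) = (\<integral>\<^sup>+y. \<integral>\<^sup>+x. f (Complex x y) \<partial>lborel \<partial>lborel)"
proof -
  have [measurable]: "(\<lambda>p. f (Complex (fst p) (snd p))) \<in> borel_measurable (lborel \<Otimes>\<^sub>M lborel)"
    by measurable
  have *: "(\<integral>\<^sup>+z. f z \<partial>lborel) = (\<integral>\<^sup>+p. f (Complex (fst p) (snd p)) \<partial>(lborel \<Otimes>\<^sub>M lborel))"
    by (subst lborel_complex_eq) (simp add: nn_integral_distr)
  show "(\<integral>\<^sup>+z. f z \<partial>lborel) = (\<integral>\<^sup>+x. \<integral>\<^sup>+y. f (Complex x y) \<partial>lborel \<partial>lborel)"
    unfolding * by (subst lborel.nn_integral_fst[symmetric]) auto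
  show "(\<integral>\<^sup>+z. f z \<partial>lborel) = (\<integral>\<^sup>+y. \<integral>\<^sup>+x. f (Complex x y) \<partial>lborel \<partial>lborel)"
    unfolding * by (subst lborel_pair.nn_integral_snd[symmetric]) auto
qed

text \<open>On each line of constant \<open>y\<close> the shear is the translation by
  \<open>t * y\<close>, so translation invariance in \<open>x\<close> suffices.\<close>

lemma nn_integral_horizontal_shear:
  assumes [measurable]: "f \<in> borel_measurable borel"
  shows "(\<integral>\<^sup>+z. f (Complex (Re z + t * Im z) (Im z)) \<partial>lborel) = (\<integral>\<^sup>+z. f z \<partial>lborel)"
proof -
  have "(\<integral>\<^sup>+z. f (Complex (Re z + t * Im z) (Im z)) \<partial>lborel)
      = (\<integral>\<^sup>+y. \<integral>\<^sup>+x. f (Complex (x + t * y) y) \<partial>lborel \<partial>lborel)"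
    by (subst nn_integral_lborel_complex(2)) auto
  also have "\<dots> = (\<integral>\<^sup>+y. \<integral>\<^sup>+x. f (Complex x y) \<partial>lborel \<partial>lborel)"
  proof (rule nn_integral_cong)
    fix y
    show "(\<integral>\<^sup>+x. f (Complex (x + t * y) y) \<partial>lborel) = (\<integral>\<^sup>+x. f (Complex x y) \<partial>lborel)"
      using nn_integral_real_affine[of "\<lambda>x. f (Complex x y)" 1 "t * y"] by (simp add: add.commute)
  qed
  finally show ?thesis by (simp add: nn_integral_lborel_complex(2))
qed

lemma nn_integral_vertical_shear:
  assumes [measurable]: "f \<in> borel_measurable borel"
  shows "(\<integral>\<^sup>+z. f (Complex (Re z) (Im z + t * Re z)) \<partial>lborel) = (\<integral>\<^sup>+z. f z \<partial>lborel)"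
proof -
  have "(\<integral>\<^sup>+z. f (Complex (Re z) (Im z + t * Re z)) \<partial>lborel)
      = (\<integral>\<^sup>+x. \<integral>\<^sup>+y. f (Complex x (y + t * x)) \<partial>lborel \<partial>lborel)"
    by (subst nn_integral_lborel_complex(1)) auto
  also have "\<dots> = (\<integral>\<^sup>+x. \<integral>\<^sup>+y. f (Complex x y) \<partial>lborel \<partial>lborel)"
  proof (rule nn_integral_cong)
    fix x
    show "(\<integral>\<^sup>+y. f (Complex x (y + t * x)) \<partial>lborel) = (\<integral>\<^sup>+y. f (Complex x y) \<partial>lborel)"
      using nn_integral_real_affine[of "\<lambda>y. f (Complex x y)" 1 "t * x"] by (simp add: add.commute)
  qed
  finally show ?thesis by (simp add: nn_integral_lborel_complex(1))
qed

lemma nn_integral_lborel_rotate: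
  assumes [measurable]: "f \<in> borel_measurable borel" and c: "cmod c = 1"
  shows "(\<integral>\<^sup>+z. f (c * z) \<partial>lborel) = (\<integral>\<^sup>+z. f z \<partial>lborel)"
proof -
  \<comment> \<open>A rotation that is not \<open>\<plusminus>1\<close> is the product of three shears.\<close>
  have nonreal: "(\<integral>\<^sup>+z. g (d * z) \<partial>lborel) = (\<integral>\<^sup>+z. g z \<partial>lborel)"
    if [measurable]: "g \<in> borel_measurable borel" and d: "cmod d = 1" "Im d \<noteq> 0"
    for d and g :: "complex \<Rightarrow> ennreal"
  proof -
    \<comment> \<open>For \<open>d = cis \<theta>\<close> this is
      \<open>- tan (\<theta> / 2)\<close>. The factorization is a horizontal shear by
      \<open>t\<close>, a vertical one by \<open>Im d\<close> and again a horizontal one by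
      \<open>t\<close>; the facts \<open>tb\<close> and \<open>ta\<close> are the matrix identities
      behind it.\<close>
    define t where "t = (Re d - 1) / Im d"
    have tb: "1 + t * Im d = Re d" using d by (simp add: t_def)
    have "(Re d)\<^sup>2 + (Im d)\<^sup>2 = 1" using d(1) by (simp add: cmod_def)
    then have "t * (1 + Re d) = - Im d"
      using d(2) unfolding t_def by (simp add: field_simps power2_eq_square)
    then have ta: "t + t * Re d = - Im d" by (simp add: algebra_simps)
    have eq: "d * z = Complex (Re z + t * Im z + t * (Im z + Im d * (Re z + t * Im z)))
        (Im z + Im d * (Re z + t * Im z))" for z
    proof -
      have "Re z + t * Im z + t * (Im z + Im d * (Re z + t * Im z))
          = (1 + t * Im d) * Re z + (t + t * (1 + t * Im d)) * Im z"
        by (simp add: algebra_simps)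
      also have "\<dots> = Re (d * z)"
        unfolding tb ta by simp
      finally have "Re (d * z) = Re z + t * Im z + t * (Im z + Im d * (Re z + t * Im z))" ..
      moreover have "Im z + Im d * (Re z + t * Im z) = Im d * Re z + (1 + t * Im d) * Im z"
        by (simp add: algebra_simps)
      then have "Im (d * z) = Im z + Im d * (Re z + t * Im z)"
        unfolding tb by simp
      ultimately show ?thesis by (simp only: complex_eq_iff complex.sel)
    qed
    have "(\<integral>\<^sup>+z. g z \<partial>lborel) = (\<integral>\<^sup>+z. g (Complex (Re z + t * Im z) (Im z)) \<partial>lborel)"
      by (rule nn_integral_horizontal_shear[symmetric]) measurable
    also have "\<dots> = (\<integral>\<^sup>+z. g (Complex (Re z + t * (Im z + Im d * Re z)) (Im z + Im d * Re z)) \<partial>lborel)"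
      by (subst nn_integral_vertical_shear[where t = "Im d", symmetric]) auto
    also have "\<dots> = (\<integral>\<^sup>+z. g (d * z) \<partial>lborel)"
      by (subst nn_integral_horizontal_shear[where t = t, symmetric]) (auto simp: eq)
    finally show ?thesis ..
  qed
  show ?thesis
  proof (cases "Im c = 0")
    case False
    with c show ?thesis by (intro nonreal) auto
  next
    case True
    \<comment> \<open>For \<open>c\<close> equal to 1 or -1 the rotation is split into two quarter
      turns, each of which has nonzero imaginary part.\<close>
    then have "c = \<i> * (\<i> * (- c))" "cmod (\<i> * (- c)) = 1" "Im (\<i> * (- c)) \<noteq> 0"
      using c by (auto simp: cmod_def norm_mult)
    then show ?thesis
      using nonreal[of "\<lambda>z. f (\<i> * z)" "\<i> * (- c)"] nonreal[of f \<i>]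
      by (simp add: mult.assoc)
  qed
qed

lemma lborel_distr_rotate:
  assumes "cmod c = 1"
  shows "distr lborel borel ((*) c) = lborel"
proof (rule measure_eqI)
  fix A :: "complex set" assume "A \<in> sets (distr lborel borel ((*) c))"
  then have A [measurable]: "A \<in> sets borel" by simp
  have "emeasure (distr lborel borel ((*) c)) A = (\<integral>\<^sup>+z. indicator A z \<partial>distr lborel borel ((*) c))"
    by simp
  also have "\<dots> = (\<integral>\<^sup>+z. indicator A (c * z) \<partial>lborel)"
    by (subst nn_integral_distr) auto
  also have "\<dots> = emeasure lborel A"
    using assms by (subst nn_integral_lborel_rotate) auto
  finally show "emeasure (distr lborel borel ((*) c)) A = emeasure lborel A" .
qed simp

section \<open>Area measure of the disk and its orthonormal system\<close>

text \<open>As a measure on its own space, the disk can serve directly as the \<open>M\<close> in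
  the results on orthonormal families.\<close>

abbreviation disk_area :: "complex measure" where
  "disk_area \<equiv> restrict_space dA unit_disk"

lemma sets_dA [simp, measurable_cong]: "sets dA = sets borel"
  by (simp add: dA_def)

lemma space_dA [simp]: "space dA = UNIV"
  by (simp add: dA_def)

lemma emeasure_dA: "A \<in> sets borel \<Longrightarrow> emeasure dA A = ennreal (1 / pi) * emeasure lborel A"
  unfolding dA_def by (subst emeasure_density) (auto simp: nn_integral_cmult)

lemma borel_measurable_disk_area:
  "f \<in> borel_measurable borel \<Longrightarrow> f \<in> borel_measurable disk_area"
  by (rule measurable_restrict_space1) simp

lemma integral_disk_area:
  fixes f :: "complex \<Rightarrow> complex"
  assumes [measurable]: "f \<in> borel_measurable borel"
  shows "(\<integral>w. f w \<partial>disk_area) = (\<integral>w. (1 / pi) *\<^sub>R (indicator unit_disk w *\<^sub>R f w) \<partial>lborel)"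
proof -
  have [measurable]: "unit_disk \<in> sets borel" by simp
  have "(\<integral>w. f w \<partial>disk_area) = (\<integral>w. indicator unit_disk w *\<^sub>R f w \<partial>dA)"
    by (rule integral_restrict_space) simp
  also have "\<dots> = (\<integral>w. (1 / pi) *\<^sub>R (indicator unit_disk w *\<^sub>R f w) \<partial>lborel)"
    unfolding dA_def by (rule integral_density) auto
  finally show ?thesis .
qed

lemma integral_disk_area_rotate:
  fixes f :: "complex \<Rightarrow> complex"
  assumes [measurable]: "f \<in> borel_measurable borel" and c: "cmod c = 1"
  shows "(\<integral>w. f (c * w) \<partial>disk_area) = (\<integral>w. f w \<partial>disk_area)"
proof -
  define F where "F w = (1 / pi) *\<^sub>R (indicator unit_disk w *\<^sub>R f w)" for w
  have [measurable]: "unit_disk \<in> sets borel" by simp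
  have [measurable]: "F \<in> borel_measurable borel" unfolding F_def by measurable
  have "(\<integral>w. f w \<partial>disk_area) = (\<integral>w. F w \<partial>distr lborel borel ((*) c))"
    by (simp add: integral_disk_area F_def lborel_distr_rotate[OF c])
  also have "\<dots> = (\<integral>w. F (c * w) \<partial>lborel)"
    by (rule integral_distr) auto
  also have "\<dots> = (\<integral>w. (1 / pi) *\<^sub>R (indicator unit_disk w *\<^sub>R f (c * w)) \<partial>lborel)"
    using c by (intro Bochner_Integration.integral_cong refl) (simp add: F_def indicator_def norm_mult)
  also have "\<dots> = (\<integral>w. f (c * w) \<partial>disk_area)"
    by (rule integral_disk_area[symmetric]) measurable
  finally show ?thesis ..
qed

text \<open>Under normalized area, the squared modulus is uniform on the unit interval: the part of
  the disk with squared modulus above \<open>x\<close> has area \<open>pi * (1 - x)\<close> for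
  \<open>x\<close> between 0 and 1. This replaces polar coordinates for radial integrands.\<close>

lemma distr_norm_squared_disk_area:
  "distr disk_area borel (\<lambda>w. (cmod w)\<^sup>2) = density lborel (indicator {0..1})"
proof (rule measure_eqI_lessThan)
  have [measurable]: "(\<lambda>w. (cmod w)\<^sup>2) \<in> borel_measurable disk_area"
    by (intro borel_measurable_disk_area) measurable
  have *: "emeasure (distr disk_area borel (\<lambda>w. (cmod w)\<^sup>2)) {x<..} = emeasure (density lborel (indicator {0..1})) {x<..}
      \<and> emeasure (distr disk_area borel (\<lambda>w. (cmod w)\<^sup>2)) {x<..} < \<infinity>" for x :: real
  proof -
    have l: "emeasure (distr disk_area borel (\<lambda>w. (cmod w)\<^sup>2)) {x<..}
        = ennreal (1 / pi) * emeasure lborel {w \<in> unit_disk. x < (cmod w)\<^sup>2}"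
      by (subst emeasure_distr, simp, simp, subst emeasure_restrict_space)
         (auto simp: space_restrict_space emeasure_dA Int_def vimage_def conj_commute intro!: arg_cong2[where f = emeasure])
    have r: "emeasure (density lborel (indicator {0..1})) {x<..} = emeasure lborel ({0..1} \<inter> {x<..})"
      by (subst emeasure_density) (auto simp: nn_integral_indicator[symmetric] indicator_inter_arith simp del: nn_integral_indicator)
    \<comment> \<open>The set in question is respectively the whole disk, the disk minus a
      concentric closed disk, and empty.\<close>
    consider "x < 0" | "0 \<le> x" "x < 1" | "1 \<le> x" by linarith
    then show ?thesis
    proof cases
      case 1
      then have "{w \<in> unit_disk. x < (cmod w)\<^sup>2} = unit_disk" "{0..1} \<inter> {x<..} = {0..1}"
        by (auto intro: less_le_trans)
      then show ?thesis
        unfolding l r by (simp add: emeasure_ball unit_ball_vol_2 ennreal_mult'[symmetric])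
    next
      case 2
      have sq: "x < (cmod w)\<^sup>2 \<longleftrightarrow> \<not> cmod w \<le> sqrt x" for w
        using real_sqrt_less_iff[of x "(cmod w)\<^sup>2"] by (simp add: not_le)
      have "{w \<in> unit_disk. x < (cmod w)\<^sup>2} = unit_disk - cball 0 (sqrt x)"
        unfolding sq by auto
      moreover have "sqrt x < 1" using 2 by simp
      then have "cball 0 (sqrt x) \<subseteq> unit_disk"
        by (intro cball_subset_ball_iff[THEN iffD2] disjI1) simp
      ultimately have "emeasure lborel {w \<in> unit_disk. x < (cmod w)\<^sup>2}
          = emeasure lborel unit_disk - emeasure lborel (cball (0::complex) (sqrt x))"
        using 2(1) by (simp add: emeasure_Diff emeasure_cball)
      also have "\<dots> = ennreal (pi * (1 - x))"
        using 2 by (simp add: emeasure_ball emeasure_cball unit_ball_vol_2 ennreal_minus algebra_simps)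
      finally have *: "ennreal (1 / pi) * emeasure lborel {w \<in> unit_disk. x < (cmod w)\<^sup>2} = ennreal (1 - x)"
        using 2 by (simp add: ennreal_mult'[symmetric])
      have "{0..1} \<inter> {x<..} = {x<..1}" using 2 by auto
      then show ?thesis
        unfolding l r * using 2 by simp
    next
      case 3
      have "(cmod w)\<^sup>2 \<le> 1" if "cmod w < 1" for w
        using that by (simp add: power_le_one)
      with 3 have *: "{w \<in> unit_disk. x < (cmod w)\<^sup>2} = {}" "{0..1} \<inter> {x<..} = {}"
        by force+
      show ?thesis unfolding l r * by simp
    qed
  qed
  show "emeasure (distr disk_area borel (\<lambda>w. (cmod w)\<^sup>2)) {x<..} = emeasure (density lborel (indicator {0..1})) {x<..}"
    "emeasure (distr disk_area borel (\<lambda>w. (cmod w)\<^sup>2)) {x<..} < \<infinity>" for x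
    using * by blast+
qed simp_all

text \<open>In the variable \<open>x = (cmod w)\<^sup>2\<close> this is the integral of
  \<open>x ^ k\<close> over the unit interval.\<close>

lemma has_bochner_integral_disk_area_power:
  "has_bochner_integral disk_area (\<lambda>w. (cmod w) ^ (2 * k)) (1 / real (Suc k))"
proof (rule has_bochner_integral_nn_integral)
  have [measurable]: "(\<lambda>w. (cmod w)\<^sup>2) \<in> borel_measurable disk_area"
    by (intro borel_measurable_disk_area) measurable
  show "(\<lambda>w. cmod w ^ (2 * k)) \<in> borel_measurable disk_area"
    by (intro borel_measurable_disk_area) measurable
  have "(\<integral>\<^sup>+w. ennreal (cmod w ^ (2 * k)) \<partial>disk_area)
      = (\<integral>\<^sup>+x. ennreal (x ^ k) \<partial>distr disk_area borel (\<lambda>w. (cmod w)\<^sup>2))"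
    by (subst nn_integral_distr) (auto simp: power_mult)
  also have "\<dots> = (\<integral>\<^sup>+x. ennreal (x ^ k) * indicator {0..1} x \<partial>lborel)"
    unfolding distr_norm_squared_disk_area
    by (subst nn_integral_density) (auto simp: mult.commute)
  also have "\<dots> = ennreal (1 ^ Suc k / real (Suc k) - 0 ^ Suc k / real (Suc k))"
  proof (rule nn_integral_FTC_Icc)
    show "((\<lambda>x. x ^ Suc k / real (Suc k)) has_real_derivative x ^ k) (at x)" for x :: real
      using DERIV_cdivide[OF DERIV_pow[of "Suc k" x UNIV], of "real (Suc k)"]
      by (simp del: of_nat_Suc power_Suc)
  qed auto
  finally show "(\<integral>\<^sup>+w. ennreal (cmod w ^ (2 * k)) \<partial>disk_area) = ennreal (1 / real (Suc k))"
    by simp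
qed auto

text \<open>Up to unimodular factors (and on the null set \<open>w = 0\<close>), these are the normalized monomials
  \<open>sqrt (k + 1) * w ^ k\<close> of the Bergman space, and their conjugates.\<close>

definition disk_basis :: "nat \<times> bool \<Rightarrow> complex \<Rightarrow> complex" where
  "disk_basis p w = complex_of_real (sqrt (real (Suc (fst p)))) *
     (if snd p then w else cnj w) ^ Suc (fst p) / complex_of_real (cmod w)"

lemma borel_measurable_disk_basis [measurable]: "disk_basis p \<in> borel_measurable borel"
proof (cases "snd p")
  case True
  then show ?thesis unfolding disk_basis_def[abs_def] by simp
next
  case False
  then show ?thesis unfolding disk_basis_def[abs_def] by simp
qed

text \<open>Each basis function is an eigenfunction of rotations, with integer weight
  \<open>k + 1\<close> or \<open>- (k + 1)\<close>. These weights are nonzero and pairwise distinct;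
  dividing by \<open>cmod w\<close> instead of \<open>w\<close> is what keeps them so, as otherwise
  the constant would coincide with its own conjugate.\<close>

lemma disk_basis_rotate:
  "disk_basis p (cis \<theta> * w) =
     cis ((if snd p then 1 else -1) * real (Suc (fst p)) * \<theta>) * disk_basis p w"
proof -
  have "cis ((if snd p then 1 else -1) * real (Suc (fst p)) * \<theta>)
      = (if snd p then cis \<theta> else cnj (cis \<theta>)) ^ Suc (fst p)"
    by (simp add: cis_cnj Complex.DeMoivre del: power_Suc of_nat_Suc)
  then show ?thesis
    by (simp add: disk_basis_def norm_mult power_mult_distrib del: power_Suc of_nat_Suc)
qed

text \<open>The squared modulus of \<open>disk_basis\<close> is
  \<open>(k + 1) * cmod w ^ (2 * k)\<close> away from the origin. At the origin this fails for
  \<open>k = 0\<close>, where division by zero gives 0 instead of 1.\<close>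

lemma AE_disk_area_nonzero: "AE w in disk_area. w \<noteq> 0"
proof -
  have "AE w in dA. w \<noteq> 0"
    unfolding dA_def using AE_lborel_singleton[of "0::complex"]
    by (subst AE_density) (auto elim: AE_mp)
  then show ?thesis
    by (subst AE_restrict_space_iff) (auto elim: AE_mp)
qed

lemma has_bochner_integral_disk_basis:
  "has_bochner_integral disk_area (\<lambda>w. (cmod (disk_basis p w))\<^sup>2) 1"
proof -
  let ?k = "fst p"
  have "has_bochner_integral disk_area (\<lambda>w. real (Suc ?k) * cmod w ^ (2 * ?k)) (real (Suc ?k) * (1 / real (Suc ?k)))"
    by (intro has_bochner_integral_mult_right has_bochner_integral_disk_area_power)
  then have *: "has_bochner_integral disk_area (\<lambda>w. real (Suc ?k) * cmod w ^ (2 * ?k)) 1"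
    by simp
  have "AE w in disk_area. real (Suc ?k) * cmod w ^ (2 * ?k) = (cmod (disk_basis p w))\<^sup>2"
    using AE_disk_area_nonzero
  proof eventually_elim
    fix w :: complex assume "w \<noteq> 0"
    then show "real (Suc ?k) * cmod w ^ (2 * ?k) = (cmod (disk_basis p w))\<^sup>2"
      by (simp add: disk_basis_def norm_mult norm_divide norm_power power_mult_distrib power_divide
          power_mult power2_eq_square field_simps power_even_eq del: of_nat_Suc)
  qed
  moreover have "(\<lambda>w. (cmod (disk_basis p w))\<^sup>2) \<in> borel_measurable disk_area"
    by (intro borel_measurable_disk_area) measurable
  ultimately show ?thesis
    using has_bochner_integral_cong_AE[of "\<lambda>w. real (Suc ?k) * cmod w ^ (2 * ?k)" disk_area] *
      borel_measurable_has_bochner_integral[OF *] by blast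
qed

lemma orthonormal_disk_basis: "orthonormal disk_area disk_basis"
  unfolding orthonormal_def
proof (intro conjI allI)
  show "square_integrable disk_area (disk_basis p)" for p
    using has_bochner_integral_disk_basis[of p]
    by (auto simp: square_integrable_def has_bochner_integral_iff intro: borel_measurable_disk_area)
  fix p q :: "nat \<times> bool"
  show "(\<integral>w. disk_basis p w * cnj (disk_basis q w) \<partial>disk_area) = (if p = q then 1 else 0)"
  proof (cases "p = q")
    case True
    have "complex_of_real (\<integral>w. (cmod (disk_basis p w))\<^sup>2 \<partial>disk_area) = 1"
      using has_bochner_integral_disk_basis[of p] by (simp add: has_bochner_integral_iff)
    with True show ?thesis
      by (simp only: complex_of_real_integral_norm_squared simp_thms if_True)
  next
    case False
    define s where "s r = (if snd r then 1 else -1) * real (Suc (fst r))" for r :: "nat \<times> bool"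
    \<comment> \<open>The angle is chosen so that the rotation multiplies the integrand by
      \<open>cis pi = -1\<close>; rotation invariance then forces \<open>J = - J\<close>.\<close>
    define \<theta> where "\<theta> = pi / (s p - s q)"
    define J where "J = (\<integral>w. disk_basis p w * cnj (disk_basis q w) \<partial>disk_area)"
    have "s p \<noteq> s q"
      using False by (cases p; cases q) (auto simp: s_def split: if_splits)
    then have "(s p - s q) * \<theta> = pi"
      by (simp add: \<theta>_def)
    then have "s p * \<theta> + - (s q * \<theta>) = pi"
      by (simp add: algebra_simps)
    then have c: "cis (s p * \<theta>) * cnj (cis (s q * \<theta>)) = -1"
      by (simp only: cis_cnj cis_mult cis_pi)
    have "J = (\<integral>w. disk_basis p (cis \<theta> * w) * cnj (disk_basis q (cis \<theta> * w)) \<partial>disk_area)"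
      unfolding J_def
      by (rule integral_disk_area_rotate[symmetric, where f = "\<lambda>w. disk_basis p w * cnj (disk_basis q w)"]) auto
    also have "\<dots> = (\<integral>w. (cis (s p * \<theta>) * cnj (cis (s q * \<theta>))) * (disk_basis p w * cnj (disk_basis q w)) \<partial>disk_area)"
      unfolding disk_basis_rotate s_def[symmetric] by (simp add: mult_ac)
    also have "\<dots> = - J"
      unfolding c J_def by simp
    finally show ?thesis
      using False by (simp add: J_def)
  qed
qed

section \<open>Gaussian power series\<close>

text \<open>The normalization prescribes second moments only. The mean vanishes because real and
  imaginary parts are centered Gaussians, taking \<open>(s, t)\<close> to be \<open>(1, 0)\<close>
  and \<open>(0, 1)\<close>; the case of a variable that is almost surely 0 is treated
  separately.\<close>

lemma (in prob_space) standard_complex_gaussian_expectation: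
  assumes "standard_complex_gaussian M \<gamma>" "square_integrable M \<gamma>"
  shows "integrable M \<gamma>" "(\<integral>\<omega>. \<gamma> \<omega> \<partial>M) = 0"
proof -
  have "square_integrable M (\<lambda>_. 1)" by (simp add: square_integrable_def)
  from square_integrable_mult[OF assms(2) this] show int: "integrable M \<gamma>" by simp
  have real: "(\<integral>\<omega>. X \<omega> \<partial>M) = 0" if "centered_gaussian M X" for X
  proof (cases "AE \<omega> in M. X \<omega> = 0")
    case True
    then show ?thesis by (rule integral_eq_zero_AE)
  next
    case False
    with that show ?thesis
      unfolding centered_gaussian_def using normal_distributed_expectation by blast
  qed
  have cg: "centered_gaussian M (\<lambda>\<omega>. s * Re (\<gamma> \<omega>) + t * Im (\<gamma> \<omega>))" for s t
    using assms(1) by (simp add: standard_complex_gaussian_def centered_complex_gaussian_def)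
  show "(\<integral>\<omega>. \<gamma> \<omega> \<partial>M) = 0"
    using real[OF cg[of 1 0]] real[OF cg[of 0 1]] int
    by (intro complex_eqI) simp_all
qed

text \<open>Mutual independence gives independence of the restrictions to the disjoint index sets
  \<open>{i}\<close> and \<open>{j}\<close>; evaluating these at their single coordinate recovers
  the two variables.\<close>

lemma (in prob_space) indep_vars_imp_indep_var:
  assumes "indep_vars N X I" "i \<in> I" "j \<in> I" "i \<noteq> j"
  shows "indep_var (N i) (X i) (N j) (X j)"
proof -
  have "indep_var (Pi\<^sub>M {i} N) (\<lambda>\<omega>. restrict (\<lambda>k. X k \<omega>) {i}) (Pi\<^sub>M {j} N) (\<lambda>\<omega>. restrict (\<lambda>k. X k \<omega>) {j})"
    using assms(2-4) by (intro indep_var_restrict[OF assms(1)]) auto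
  then have "indep_var (N i) ((\<lambda>f. f i) \<circ> (\<lambda>\<omega>. restrict (\<lambda>k. X k \<omega>) {i}))
      (N j) ((\<lambda>f. f j) \<circ> (\<lambda>\<omega>. restrict (\<lambda>k. X k \<omega>) {j}))"
    by (rule indep_var_compose) (auto intro: measurable_component_singleton)
  then show ?thesis by (simp add: comp_def)
qed

text \<open>Off the diagonal, independence factors the expectation into a product of two vanishing
  means; on the diagonal it is the normalized second moment.\<close>

lemma (in prob_space) orthonormal_standard_complex_gaussian:
  assumes G: "\<And>k. standard_complex_gaussian M (e k)" "\<And>k. square_integrable M (e k)"
    and indep: "\<And>j k. j \<noteq> k \<Longrightarrow> indep_var borel (e j) borel (e k)"
  shows "orthonormal M e"
  unfolding orthonormal_def
proof (intro conjI allI G)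
  fix j k
  show "(\<integral>\<omega>. e j \<omega> * cnj (e k \<omega>) \<partial>M) = (if j = k then 1 else 0)"
  proof (cases "j = k")
    case True
    have "complex_of_real (\<integral>\<omega>. (cmod (e j \<omega>))\<^sup>2 \<partial>M) = 1"
      using G(1)[of j] by (simp add: standard_complex_gaussian_def)
    with True show ?thesis
      by (simp only: complex_of_real_integral_norm_squared simp_thms if_True)
  next
    case False
    have "indep_var borel (id \<circ> e j) borel (cnj \<circ> e k)"
      by (intro indep_var_compose[OF indep[OF False]]) auto
    then have "indep_var borel (e j) borel (\<lambda>\<omega>. cnj (e k \<omega>))"
      by (simp add: comp_def)
    then have "(\<integral>\<omega>. e j \<omega> * cnj (e k \<omega>) \<partial>M) = (\<integral>\<omega>. e j \<omega> \<partial>M) * (\<integral>\<omega>. cnj (e k \<omega>) \<partial>M)"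
      using standard_complex_gaussian_expectation(1)[OF G]
      by (intro indep_var_lebesgue_integral) auto
    then show ?thesis
      using False standard_complex_gaussian_expectation(2)[OF G] by simp
  qed
qed

text \<open>The definition is recast in the form used for orthonormal series, with the deterministic
  coefficient first and \<open>e k\<close> standing for \<open>\<alpha> (Suc k)\<close>.\<close>

lemma D0_GAF_expansion:
  assumes "gaussian_hilbert_space M G" "D0_GAF M G \<Phi>"
  obtains e where "orthonormal M e"
    "AE \<omega> in M. \<forall>z\<in>unit_disk.
       (\<lambda>k. z ^ Suc k / complex_of_real (sqrt (real (Suc k))) * e k \<omega>) sums \<Phi> z \<omega>"
proof -
  interpret gaussian_hilbert_space M G by fact
  obtain \<alpha> :: "nat \<Rightarrow> 'a \<Rightarrow> complex" where
    \<alpha>: "\<And>j. j \<ge> 1 \<Longrightarrow> \<alpha> j \<in> G" "\<And>j. j \<ge> 1 \<Longrightarrow> standard_complex_gaussian M (\<alpha> j)"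
    and indep: "indep_vars (\<lambda>_. borel) \<alpha> {1..}"
    and sums: "AE \<omega> in M. \<forall>z\<in>unit_disk.
      (\<lambda>j. \<alpha> (Suc j) \<omega> / complex_of_real (sqrt (real (Suc j))) * z ^ Suc j) sums \<Phi> z \<omega>"
    using assms(2) unfolding D0_GAF_def by blast
  show thesis
  proof
    show "orthonormal M (\<lambda>k. \<alpha> (Suc k))"
    proof (rule orthonormal_standard_complex_gaussian)
      fix j k :: nat assume "j \<noteq> k"
      then show "indep_var borel (\<alpha> (Suc j)) borel (\<alpha> (Suc k))"
        by (intro indep_vars_imp_indep_var[OF indep, of "Suc j" "Suc k"]) auto
    qed (use \<alpha> square_integrable in force)+
    show "AE \<omega> in M. \<forall>z\<in>unit_disk.
       (\<lambda>k. z ^ Suc k / complex_of_real (sqrt (real (Suc k))) * \<alpha> (Suc k) \<omega>) sums \<Phi> z \<omega>"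
      using sums by (simp add: mult_ac)
  qed
qed

text \<open>The squared moduli of the coefficients add up to the logarithmic series at
  \<open>(cmod z)\<^sup>2\<close>.\<close>

lemma D0_GAF_norm_squared:
  assumes "gaussian_hilbert_space M G" "D0_GAF M G \<Phi>" "z \<in> unit_disk"
  shows "square_integrable M (\<Phi> z)"
    and "(\<integral>\<omega>. (cmod (\<Phi> z \<omega>))\<^sup>2 \<partial>M) \<le> ln (1 / (1 - (cmod z)\<^sup>2))"
proof -
  obtain e where e: "orthonormal M e" and sums: "AE \<omega> in M. \<forall>z\<in>unit_disk.
       (\<lambda>k. z ^ Suc k / complex_of_real (sqrt (real (Suc k))) * e k \<omega>) sums \<Phi> z \<omega>"
    using D0_GAF_expansion[OF assms(1,2)] .
  define c where "c k = z ^ Suc k / complex_of_real (sqrt (real (Suc k)))" for k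
  have r: "(cmod z)\<^sup>2 < 1"
    using assms(3) by (simp add: power_less_one_iff)
  have c2: "(cmod (c k))\<^sup>2 = ((cmod z)\<^sup>2) ^ Suc k / real (Suc k)" for k
    by (simp add: c_def norm_divide norm_power power_divide power_mult_distrib
        del: of_nat_Suc power_Suc flip: power_mult) (simp add: mult.commute)
  have "(\<lambda>n. - ((-(- (cmod z)\<^sup>2)) ^ n) / real n) sums ln (1 + (- (cmod z)\<^sup>2))"
    by (rule ln_series') (use r in simp)
  \<comment> \<open>The term of index 0 is a division by zero and hence 0, so dropping it leaves the
    sum unchanged.\<close>
  then have "(\<lambda>n. - (((cmod z)\<^sup>2) ^ Suc n) / real (Suc n)) sums ln (1 - (cmod z)\<^sup>2)"
    by (subst sums_Suc_iff) simp
  from sums_minus[OF this] have "(\<lambda>k. (cmod (c k))\<^sup>2) sums ln (1 / (1 - (cmod z)\<^sup>2))"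
    using r by (simp add: c2 ln_div del: of_nat_Suc power_Suc)
  then have c_sum: "summable (\<lambda>k. (cmod (c k))\<^sup>2)"
    and c_suminf: "(\<Sum>k. (cmod (c k))\<^sup>2) = ln (1 / (1 - (cmod z)\<^sup>2))"
    by (auto simp: sums_iff)
  have meas: "\<Phi> z \<in> borel_measurable M"
    using assms(2,3) by (simp add: D0_GAF_def random_analytic_function_def)
  have lim: "AE \<omega> in M. (\<lambda>k. c k * e k \<omega>) sums \<Phi> z \<omega>"
    using sums by eventually_elim (use assms(3) in \<open>simp add: c_def\<close>)
  note s = orthonormal_series[OF e c_sum lim meas]
  show "square_integrable M (\<Phi> z)" by (rule s)
  show "(\<integral>\<omega>. (cmod (\<Phi> z \<omega>))\<^sup>2 \<partial>M) \<le> ln (1 / (1 - (cmod z)\<^sup>2))"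
    using s(2) by (simp only: c_suminf)
qed

section \<open>The derivative of a Gaussian power series\<close>

text \<open>For every outcome the derivative is the limit of difference quotients along one fixed
  sequence of increments, and each quotient is measurable.\<close>

lemma borel_measurable_random_deriv:
  assumes "random_analytic_function M \<Psi>" and w: "w \<in> unit_disk"
  shows "random_deriv \<Psi> w \<in> borel_measurable M"
proof -
  \<comment> \<open>The increments are nonzero and tend to 0. The denominator starts at 2, so
    already the first one is shorter than the distance \<open>1 - cmod w\<close> to the boundary and
    \<open>w + h n\<close> stays in the disk.\<close>
  define h where "h n = complex_of_real ((1 - cmod w) / real (Suc (Suc n)))" for n
  have pos: "0 < 1 - cmod w" using w by simp
  have h0: "h \<longlonglongrightarrow> 0"
  proof -
    have "(\<lambda>n. (1 - cmod w) / real n) \<longlonglongrightarrow> 0"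
      by (rule lim_const_over_n)
    from LIMSEQ_Suc[OF LIMSEQ_Suc[OF this]]
    have "(\<lambda>n. complex_of_real ((1 - cmod w) / real (Suc (Suc n)))) \<longlonglongrightarrow> complex_of_real 0"
      unfolding tendsto_of_real_iff .
    then show ?thesis by (simp add: h_def[abs_def] del: of_nat_Suc)
  qed
  have disk: "w + h n \<in> unit_disk" for n
  proof -
    have "cmod (h n) < 1 - cmod w"
    proof -
      have "cmod (h n) = (1 - cmod w) / real (Suc (Suc n))"
        using pos unfolding h_def norm_of_real by simp
      also have "\<dots> < (1 - cmod w) / 1"
        using pos by (intro divide_strict_left_mono) auto
      finally show ?thesis by simp
    qed
    then show ?thesis using norm_triangle_ineq[of w "h n"] by simp
  qed
  show ?thesis
  proof (rule borel_measurable_LIMSEQ_metric)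
    show "(\<lambda>\<omega>. (\<Psi> (w + h n) \<omega> - \<Psi> w \<omega>) / h n) \<in> borel_measurable M" for n
      using assms(1) disk[of n] w unfolding random_analytic_function_def
      by (intro borel_measurable_divide borel_measurable_diff borel_measurable_const) blast+
    fix \<omega> assume "\<omega> \<in> space M"
    then have "(\<lambda>u. \<Psi> u \<omega>) holomorphic_on unit_disk"
      using assms(1) by (simp add: random_analytic_function_def)
    then have "((\<lambda>u. \<Psi> u \<omega>) has_field_derivative random_deriv \<Psi> w \<omega>) (at w)"
      unfolding random_deriv_def using w by (intro holomorphic_derivI) auto
    then have "((\<lambda>x. (\<Psi> (w + x) \<omega> - \<Psi> w \<omega>) / x) \<longlongrightarrow> random_deriv \<Psi> w \<omega>) (at 0)"
      by (simp add: DERIV_def)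
    moreover have "filterlim h (at 0) sequentially"
    proof -
      have "h n \<noteq> 0" for n
        using pos unfolding h_def of_real_eq_0_iff by simp
      with h0 show ?thesis by (simp add: filterlim_at)
    qed
    ultimately show "(\<lambda>n. (\<Psi> (w + h n) \<omega> - \<Psi> w \<omega>) / h n) \<longlonglongrightarrow> random_deriv \<Psi> w \<omega>"
      by (rule filterlim_compose)
  qed
qed

lemma summable_Suc_mult_power:
  fixes x :: real
  assumes "\<bar>x\<bar> < 1"
  shows "summable (\<lambda>k. real (Suc k) * x ^ k)"
proof -
  have "(\<lambda>k. of_nat (Suc k) * x ^ k) sums (1 / (1 - x)\<^sup>2)"
    by (rule geometric_deriv_sums) (use assms in simp)
  then show ?thesis by (rule sums_summable)
qed

text \<open>Outside one null set, the same for all \<open>w\<close>, the power series converges on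
  the whole disk and may be differentiated term by term.\<close>

lemma D0_GAF_deriv_expansion:
  assumes "gaussian_hilbert_space M G" "D0_GAF M G \<Psi>"
  obtains e where "orthonormal M e"
    "AE \<omega> in M. \<forall>w\<in>unit_disk.
       (\<lambda>k. (complex_of_real (sqrt (real (Suc k))) * w ^ k) * e k \<omega>) sums random_deriv \<Psi> w \<omega>"
proof -
  obtain e where e: "orthonormal M e" and sums: "AE \<omega> in M. \<forall>z\<in>unit_disk.
       (\<lambda>k. z ^ Suc k / complex_of_real (sqrt (real (Suc k))) * e k \<omega>) sums \<Psi> z \<omega>"
    using D0_GAF_expansion[OF assms] .
  have "AE \<omega> in M. \<forall>w\<in>unit_disk.
       (\<lambda>k. (complex_of_real (sqrt (real (Suc k))) * w ^ k) * e k \<omega>) sums random_deriv \<Psi> w \<omega>"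
    using sums AE_space
  proof eventually_elim
    fix \<omega>
    assume sums: "\<forall>z\<in>unit_disk. (\<lambda>k. z ^ Suc k / complex_of_real (sqrt (real (Suc k))) * e k \<omega>) sums \<Psi> z \<omega>"
      and \<omega>: "\<omega> \<in> space M"
    \<comment> \<open>These are the coefficients of the full power series, starting at index 0 with
      the value 0, as \<open>diffs\<close> expects.\<close>
    define d where "d n = (if n = 0 then 0 else e (n - 1) \<omega> / complex_of_real (sqrt (real n)))" for n
    have d: "(\<lambda>n. d n * u ^ n) sums \<Psi> u \<omega>" if "cmod u < 1" for u
    proof -
      have "(\<lambda>n. d (Suc n) * u ^ Suc n) sums \<Psi> u \<omega>"
        using sums that by (simp add: d_def mult_ac)
      then show ?thesis
        by (subst (asm) sums_Suc_iff[of "\<lambda>n. d n * u ^ n"]) (simp add: d_def)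
    qed
    \<comment> \<open>Differentiation multiplies the coefficient by \<open>k + 1\<close>, and
      \<open>(k + 1) / sqrt (k + 1) = sqrt (k + 1)\<close>.\<close>
    have diffs_d: "diffs d k = complex_of_real (sqrt (real (Suc k))) * e k \<omega>" for k
    proof -
      define s where "s = complex_of_real (sqrt (real (Suc k)))"
      have "of_nat (Suc k) = s * s"
        unfolding s_def of_real_mult[symmetric] by simp
      moreover have "s \<noteq> 0" by (simp add: s_def del: of_nat_Suc)
      ultimately show ?thesis
        by (simp add: diffs_def d_def s_def[symmetric] del: of_nat_Suc)
    qed
    show "\<forall>w\<in>unit_disk. (\<lambda>k. (complex_of_real (sqrt (real (Suc k))) * w ^ k) * e k \<omega>) sums random_deriv \<Psi> w \<omega>"
    proof
      fix w :: complex assume w: "w \<in> unit_disk"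
      have "(\<lambda>u. \<Psi> u \<omega>) holomorphic_on unit_disk"
        using assms(2) \<omega> by (simp add: D0_GAF_def random_analytic_function_def)
      then have "((\<lambda>u. \<Psi> u \<omega>) has_field_derivative random_deriv \<Psi> w \<omega>) (at w)"
        unfolding random_deriv_def using w by (intro holomorphic_derivI) auto
      then have "(\<lambda>k. diffs d k * w ^ k) sums random_deriv \<Psi> w \<omega>"
        using w by (intro termdiffs_sums_strong[of 1 d "\<lambda>u. \<Psi> u \<omega>", OF d]) auto
      then show "(\<lambda>k. (complex_of_real (sqrt (real (Suc k))) * w ^ k) * e k \<omega>) sums random_deriv \<Psi> w \<omega>"
        by (simp add: diffs_d mult_ac del: of_nat_Suc)
    qed
  qed
  with e show thesis by (rule that)
qed

text \<open>For fixed \<open>w\<close> the coefficients \<open>sqrt (k + 1) * w ^ k\<close> are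
  square summable, so the expansion of the derivative can be integrated against any square
  integrable \<open>g\<close>. The second series uses the conjugated family. One \<open>e\<close>
  serves all \<open>g\<close> and \<open>w\<close>.\<close>

lemma D0_GAF_correlation_expansion:
  assumes "gaussian_hilbert_space M G" "D0_GAF M G \<Psi>"
  obtains e where "orthonormal M e"
    "\<And>g w. square_integrable M g \<Longrightarrow> w \<in> unit_disk \<Longrightarrow>
       (\<lambda>k. (complex_of_real (sqrt (real (Suc k))) * w ^ k) * (\<integral>\<omega>. g \<omega> * e k \<omega> \<partial>M))
         sums (\<integral>\<omega>. g \<omega> * random_deriv \<Psi> w \<omega> \<partial>M)"
    "\<And>g w. square_integrable M g \<Longrightarrow> w \<in> unit_disk \<Longrightarrow>
       (\<lambda>k. (complex_of_real (sqrt (real (Suc k))) * cnj w ^ k) * (\<integral>\<omega>. g \<omega> * cnj (e k \<omega>) \<partial>M))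
         sums (\<integral>\<omega>. g \<omega> * cnj (random_deriv \<Psi> w \<omega>) \<partial>M)"
proof -
  obtain e where e: "orthonormal M e" and sums: "AE \<omega> in M. \<forall>w\<in>unit_disk.
       (\<lambda>k. (complex_of_real (sqrt (real (Suc k))) * w ^ k) * e k \<omega>) sums random_deriv \<Psi> w \<omega>"
    using D0_GAF_deriv_expansion[OF assms] .
  have summable: "summable (\<lambda>k. (cmod (complex_of_real (sqrt (real (Suc k))) * u ^ k))\<^sup>2)"
    if "cmod u < 1" for u
  proof -
    have "(cmod (complex_of_real (sqrt (real (Suc k))) * u ^ k))\<^sup>2 = real (Suc k) * ((cmod u)\<^sup>2) ^ k" for k
      by (simp add: norm_mult norm_power power_mult_distrib del: of_nat_Suc flip: power_mult)
         (simp add: mult.commute)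
    then show ?thesis
      using summable_Suc_mult_power[of "(cmod u)\<^sup>2"] that
      by (simp add: power_less_one_iff del: of_nat_Suc)
  qed
  have meas: "random_deriv \<Psi> w \<in> borel_measurable M" if "w \<in> unit_disk" for w
    using assms(2) that by (intro borel_measurable_random_deriv) (auto simp: D0_GAF_def)
  show thesis
  proof (rule that[OF e])
    fix g w assume g: "square_integrable M g" and w: "w \<in> unit_disk"
    show "(\<lambda>k. (complex_of_real (sqrt (real (Suc k))) * w ^ k) * (\<integral>\<omega>. g \<omega> * e k \<omega> \<partial>M))
         sums (\<integral>\<omega>. g \<omega> * random_deriv \<Psi> w \<omega> \<partial>M)"
    proof (rule orthonormal_series_integral[OF e _ _ meas[OF w] g])
      show "AE \<omega> in M. (\<lambda>k. (complex_of_real (sqrt (real (Suc k))) * w ^ k) * e k \<omega>) sums random_deriv \<Psi> w \<omega>"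
        using sums by eventually_elim (use w in blast)
    qed (use w in \<open>intro summable, simp\<close>)
    show "(\<lambda>k. (complex_of_real (sqrt (real (Suc k))) * cnj w ^ k) * (\<integral>\<omega>. g \<omega> * cnj (e k \<omega>) \<partial>M))
         sums (\<integral>\<omega>. g \<omega> * cnj (random_deriv \<Psi> w \<omega>) \<partial>M)"
    proof (rule orthonormal_series_integral[OF orthonormal_cnj[OF e] _ _ _ g])
      show "AE \<omega> in M. (\<lambda>k. (complex_of_real (sqrt (real (Suc k))) * cnj w ^ k) * cnj (e k \<omega>))
          sums cnj (random_deriv \<Psi> w \<omega>)"
        using sums
      proof eventually_elim
        fix \<omega>
        assume "\<forall>w\<in>unit_disk. (\<lambda>k. (complex_of_real (sqrt (real (Suc k))) * w ^ k) * e k \<omega>)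
          sums random_deriv \<Psi> w \<omega>"
        with w have "(\<lambda>k. cnj ((complex_of_real (sqrt (real (Suc k))) * w ^ k) * e k \<omega>))
          sums cnj (random_deriv \<Psi> w \<omega>)"
          unfolding sums_cnj by blast
        then show "(\<lambda>k. (complex_of_real (sqrt (real (Suc k))) * cnj w ^ k) * cnj (e k \<omega>))
          sums cnj (random_deriv \<Psi> w \<omega>)" by simp
      qed
      show "(\<lambda>\<omega>. cnj (random_deriv \<Psi> w \<omega>)) \<in> borel_measurable M"
        using measurable_compose[OF meas[OF w] borel_measurable_cnj] .
    qed (use w in \<open>intro summable, simp\<close>)
  qed
qed

section \<open>The integral estimate\<close>

theorem theorem1p6p1:
  fixes M :: "'w measure" and G :: "('w \<Rightarrow> complex) set"
    and \<Phi> \<Psi> :: "complex \<Rightarrow> 'w \<Rightarrow> complex" and a b z :: complex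
  assumes "jointly_gaussian_D0_GAFs M G \<Phi> \<Psi>"
    and "z \<in> unit_disk"
  shows "set_integrable dA unit_disk (correlation_integrand M \<Phi> \<Psi> a b z) \<and>
    (LINT w:unit_disk|dA. correlation_integrand M \<Phi> \<Psi> a b z w)
      \<le> ((cmod a)\<^sup>2 + (cmod b)\<^sup>2) * ln (1 / (1 - (cmod z)\<^sup>2))"
proof -
  have GHS: "gaussian_hilbert_space M G" and \<Phi>: "D0_GAF M G \<Phi>" and \<Psi>: "D0_GAF M G \<Psi>"
    using assms(1) by (auto simp: jointly_gaussian_D0_GAFs_def)
  define L where "L = ln (1 / (1 - (cmod z)\<^sup>2))"
  have si: "square_integrable M (\<Phi> z)" and L: "(\<integral>\<omega>. (cmod (\<Phi> z \<omega>))\<^sup>2 \<partial>M) \<le> L"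
    using D0_GAF_norm_squared[OF GHS \<Phi> assms(2)] by (simp_all add: L_def)
  obtain e where e: "orthonormal M e"
    and exp: "\<And>g w. square_integrable M g \<Longrightarrow> w \<in> unit_disk \<Longrightarrow>
       (\<lambda>k. (complex_of_real (sqrt (real (Suc k))) * w ^ k) * (\<integral>\<omega>. g \<omega> * e k \<omega> \<partial>M))
         sums (\<integral>\<omega>. g \<omega> * random_deriv \<Psi> w \<omega> \<partial>M)"
    and exp_cnj: "\<And>g w. square_integrable M g \<Longrightarrow> w \<in> unit_disk \<Longrightarrow>
       (\<lambda>k. (complex_of_real (sqrt (real (Suc k))) * cnj w ^ k) * (\<integral>\<omega>. g \<omega> * cnj (e k \<omega>) \<partial>M))
         sums (\<integral>\<omega>. g \<omega> * cnj (random_deriv \<Psi> w \<omega>) \<partial>M)"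
    using D0_GAF_correlation_expansion[OF GHS \<Psi>] by blast
  define c where "c k = (\<integral>\<omega>. \<Phi> z \<omega> * e k \<omega> \<partial>M)" for k
  define d where "d k = (\<integral>\<omega>. \<Phi> z \<omega> * cnj (e k \<omega>) \<partial>M)" for k
  \<comment> \<open>The \<open>c k\<close> are the Fourier coefficients of \<open>\<Phi> z\<close>
    for the conjugated family, the \<open>d k\<close> those for \<open>e\<close> itself.\<close>
  have bessel: "(\<Sum>k<n. (cmod (c k))\<^sup>2) \<le> L" "(\<Sum>k<n. (cmod (d k))\<^sup>2) \<le> L" for n
    using Bessel_inequality[OF orthonormal_cnj[OF e] finite_lessThan si, of n]
      Bessel_inequality[OF e finite_lessThan si, of n] L
    by (simp_all add: c_def d_def)
  \<comment> \<open>Dividing by the modulus inside makes the integrand a plain squared modulus, also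
    at the origin, where both sides are 0.\<close>
  define f where "f w = (a * w * (\<integral>\<omega>. \<Phi> z \<omega> * random_deriv \<Psi> w \<omega> \<partial>M)
      + b * cnj w * (\<integral>\<omega>. \<Phi> z \<omega> * cnj (random_deriv \<Psi> w \<omega>) \<partial>M)) / complex_of_real (cmod w)" for w
  have integrand: "correlation_integrand M \<Phi> \<Psi> a b z w = (cmod (f w))\<^sup>2" for w
    by (simp add: correlation_integrand_def f_def norm_divide power_divide)
  define x where "x p = (if snd p then a * c (fst p) else b * d (fst p))" for p
  \<comment> \<open>Both functions of each degree enter together, so \<open>T n\<close> is the
    \<open>n\<close>-th partial sum of the two correlation series at once.\<close>
  define T where "T n w = (\<Sum>p\<in>{..<n} \<times> UNIV. x p * disk_basis p w)" for n w
  have T_si: "square_integrable disk_area (T n)" for n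
    unfolding T_def using orthonormal_disk_basis
    by (intro square_integrable_sum square_integrable_cmult) auto
  have T_norm: "(\<integral>w. (cmod (T n w))\<^sup>2 \<partial>disk_area) \<le> ((cmod a)\<^sup>2 + (cmod b)\<^sup>2) * L" for n
  proof -
    have "(\<integral>w. (cmod (T n w))\<^sup>2 \<partial>disk_area) = (\<Sum>p\<in>{..<n} \<times> UNIV. (cmod (x p))\<^sup>2)"
      unfolding T_def by (rule integral_norm_squared_orthonormal_sum[OF orthonormal_disk_basis]) simp
    also have "\<dots> = (cmod a)\<^sup>2 * (\<Sum>k<n. (cmod (c k))\<^sup>2) + (cmod b)\<^sup>2 * (\<Sum>k<n. (cmod (d k))\<^sup>2)"
      by (simp add: sum.cartesian_product' x_def UNIV_bool norm_mult power_mult_distrib sum.distrib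
          sum_distrib_left)
    also have "\<dots> \<le> (cmod a)\<^sup>2 * L + (cmod b)\<^sup>2 * L"
      by (intro add_mono mult_left_mono bessel) auto
    finally show ?thesis by (simp add: algebra_simps)
  qed
  have T_lim: "(\<lambda>n. T n w) \<longlonglongrightarrow> f w" if w: "w \<in> unit_disk" for w
  proof -
    have "(\<lambda>k. a * w * ((complex_of_real (sqrt (real (Suc k))) * w ^ k) * c k)
        + b * cnj w * ((complex_of_real (sqrt (real (Suc k))) * cnj w ^ k) * d k))
      sums (a * w * (\<integral>\<omega>. \<Phi> z \<omega> * random_deriv \<Psi> w \<omega> \<partial>M)
        + b * cnj w * (\<integral>\<omega>. \<Phi> z \<omega> * cnj (random_deriv \<Psi> w \<omega>) \<partial>M))"
      unfolding c_def d_def by (intro sums_add sums_mult exp exp_cnj si w)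
    \<comment> \<open>The factors \<open>w\<close> and \<open>cnj w\<close> raise the exponent
      \<open>k\<close> of the derivative series to the \<open>Suc k\<close> in
      \<open>disk_basis\<close>.\<close>
    from sums_divide[OF this, of "complex_of_real (cmod w)"]
    have "(\<lambda>k. x (k, True) * disk_basis (k, True) w + x (k, False) * disk_basis (k, False) w) sums f w"
      by (simp add: f_def x_def disk_basis_def add_divide_distrib mult_ac del: of_nat_Suc)
    moreover have "T n w = (\<Sum>k<n. x (k, True) * disk_basis (k, True) w + x (k, False) * disk_basis (k, False) w)" for n
      by (simp add: T_def sum.cartesian_product' UNIV_bool add.commute)
    ultimately show ?thesis by (simp add: sums_def)
  qed
  \<comment> \<open>Measurability in \<open>w\<close> of the two expectations is not given directly;
    it follows from the pointwise convergence of the \<open>T n\<close> on the disk.\<close>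
  have f_meas: "f \<in> borel_measurable disk_area"
  proof (rule borel_measurable_LIMSEQ_metric)
    show "T n \<in> borel_measurable disk_area" for n
      using T_si by (simp add: square_integrable_def)
  qed (use T_lim in \<open>simp add: space_restrict_space\<close>)
  have "AE w in disk_area. (\<lambda>n. T n w) \<longlonglongrightarrow> f w"
    by (rule AE_I2) (use T_lim in \<open>simp add: space_restrict_space\<close>)
  \<comment> \<open>This yields integrability and the bound at the same time; what remains is to
    pass from the restricted measure to the set integral.\<close>
  note fatou = Fatou_square_integrable[OF T_si T_norm this f_meas]
  have "set_integrable dA unit_disk (correlation_integrand M \<Phi> \<Psi> a b z)"
    using fatou(1) unfolding square_integrable_def set_integrable_def integrand
    by (subst (asm) integrable_restrict_space) auto
  moreover have "(LINT w:unit_disk|dA. correlation_integrand M \<Phi> \<Psi> a b z w)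
      = (\<integral>w. (cmod (f w))\<^sup>2 \<partial>disk_area)"
    unfolding set_lebesgue_integral_def integrand
    by (rule integral_restrict_space[symmetric]) simp
  ultimately show ?thesis
    using fatou(2) by (simp add: L_def)
qed

end
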